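(* Let $\mathcal F=\mathbb R[x_1,x_2,\ldots]$ and define polynomials $g(d,\ell)$ by $$\exp\Big(r\sum_{j\ge1}x_j z^j\Big)=1+\sum_{d\ge\ell\ge1} g(d,\ell)\,r^\ell z^d.$$ Let $d\ge \ell\ge1$. Let $S(d,\ell)$ be the set of products $g(d_1,\ell_1)g(d_2,\ell_2)\cdots g(d_k,\ell_k)$, with $k\ge1$, satisfying all of the following: - $\sum_{i=1}^k d_i=d$ and $\sum_{i=1}^k \ell_i=\ell$; - $d_i>d_{i+1}+\ell_i$ for $i<k$; - $d_k\ge\ell_k$; - $\ell_1,\ldots,\ell_k\ge1$. Then $S(d,\ell)$ is a basis of $\mathcal F(d,\ell)$.
   Context: $\mathcal F(d,\ell)$ denotes the span of all monomials $x_{i_1}\cdots x_{i_\ell}$ with $i_1+\cdots+i_\ell=d$, that is, monomials of degree $d$ (where $\deg x_k=k$) and length $\ell$. Each $g(d,\ell)$ lies in $\mathcal F(d,\ell)$. *)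

theory Defs
  imports
    Complex_Main
    "HOL-Library.Poly_Mapping"
    "HOL-Computational_Algebra.Polynomial"
    "HOL-Computational_Algebra.Formal_Power_Series"
begin

instantiation poly_mapping :: (type, real_vector) real_vector
begin

lift_definition scaleR_poly_mapping :: "real \<Rightarrow> ('a \<Rightarrow>\<^sub>0 'b) \<Rightarrow> 'a \<Rightarrow>\<^sub>0 'b"
  is "\<lambda>c p k. c *\<^sub>R p k"
proof -
  fix c :: real and p :: "'a \<Rightarrow> 'b"
  assume "finite {k. p k \<noteq> 0}"
  then show "finite {k. c *\<^sub>R p k \<noteq> 0}"
    by (rule rev_finite_subset) auto
qed

instance
  by standard (transfer; simp add: fun_eq_iff scaleR_add_right scaleR_add_left)+

end

lemma lookup_scaleR [simp]: "Poly_Mapping.lookup (c *\<^sub>R p) k = c *\<^sub>R Poly_Mapping.lookup p k"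
  by transfer simp

lemma scaleR_single [simp]: "c *\<^sub>R Poly_Mapping.single k a = Poly_Mapping.single k (c *\<^sub>R a)"
  by (rule poly_mapping_eqI) (simp add: lookup_single when_def)

lemma scaleR_poly_mapping_conv_mult:
  fixes p :: "'a::monoid_add \<Rightarrow>\<^sub>0 'b::real_algebra_1"
  shows "c *\<^sub>R p = Poly_Mapping.single 0 (of_real c) * p"
proof (rule poly_mapping_eqI)
  fix k
  have "Poly_Mapping.lookup (Poly_Mapping.single 0 (of_real c) * p) k =
      Sum_any (\<lambda>q. of_real c * Poly_Mapping.lookup p q when k = q)"
    by (simp add: lookup_mult lookup_single Sum_any_when_equal' when_mult)
  then show "Poly_Mapping.lookup (c *\<^sub>R p) k = Poly_Mapping.lookup (Poly_Mapping.single 0 (of_real c) * p) k"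
    by (simp add: scaleR_conv_of_real)
qed

instance poly_mapping :: (comm_monoid_add, "{real_algebra_1, comm_ring_1}") real_algebra_1
  by standard (simp_all add: scaleR_poly_mapping_conv_mult mult_ac)

text \<open>
  The ring of real polynomials in the variables \<open>x\<^sub>1, x\<^sub>2, \<dots>\<close>: a polynomial maps exponent vectors
  to coefficients. Position \<open>i\<close> of an exponent vector holds the exponent of \<open>x\<^bsub>i+1\<^esub>\<close>, so that
  there is no variable \<open>x\<^sub>0\<close>.
\<close>
type_synonym real_mpoly = "(nat \<Rightarrow>\<^sub>0 nat) \<Rightarrow>\<^sub>0 real"

text \<open>Only meant for \<open>k \<ge> 1\<close>.\<close>
definition var_x :: "nat \<Rightarrow> real_mpoly"
  where "var_x k = Poly_Mapping.single (Poly_Mapping.single (k - 1) 1) 1"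

text \<open>
  The series \<open>r (x\<^sub>1 z + x\<^sub>2 z\<^sup>2 + \<dots>)\<close> as a formal power series in \<open>z\<close> whose coefficients are
  polynomials in \<open>r\<close>; here \<open>r\<close> is \<open>[:0, 1:]\<close>.
\<close>
definition rx_series :: "real_mpoly poly fps"
  where "rx_series = fps_const [:0, 1:] * Abs_fps (\<lambda>j. if j = 0 then 0 else [:var_x j:])"

text \<open>
  The exponential series; \<^const>\<open>fps_exp\<close> is only available over fields. Composing it with a series
  without constant term, such as \<^const>\<open>rx_series\<close>, gives the exponential of that series.
\<close>
definition exp_series :: "real_mpoly poly fps"
  where "exp_series = Abs_fps (\<lambda>n. [:of_real (1 / fact n):])"

definition g_poly :: "nat \<Rightarrow> nat \<Rightarrow> real_mpoly"
  where "g_poly d l = coeff (fps_nth (exp_series oo rx_series) d) l"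

lemma g_generating_function:
  "exp_series oo rx_series =
     1 + Abs_fps (\<lambda>d. \<Sum>l=1..d. Polynomial.monom (g_poly d l) l)"
proof -
  define A where "A = Abs_fps (\<lambda>j. if j = 0 then 0 else [:var_x j:])"
  have coeff_term: "coeff (fps_nth (rx_series ^ i) d) l = (if l = i then coeff (fps_nth (A ^ i) d) 0 else 0)"
    for i d l
  proof -
    have const: "Polynomial.degree (fps_nth (A ^ i) d) = 0" for d
    proof (induction i arbitrary: d)
      case 0
      then show ?case by (cases d) auto
    next
      case (Suc i)
      have "Polynomial.degree (fps_nth A k * fps_nth (A ^ i) m) \<le> 0" for k m
        using degree_mult_le[of "fps_nth A k" "fps_nth (A ^ i) m"] Suc[of m]
        by (simp add: A_def split: if_splits)
      then have "Polynomial.degree (fps_nth (A ^ Suc i) d) \<le> 0"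
        unfolding power_Suc fps_mult_nth by (intro degree_sum_le) auto
      then show ?case by simp
    qed
    have "rx_series ^ i = fps_const ([:0, 1:] ^ i) * A ^ i"
      by (simp add: rx_series_def A_def power_mult_distrib fps_const_power)
    then have "fps_nth (rx_series ^ i) d = Polynomial.monom 1 i * fps_nth (A ^ i) d"
      by (simp add: monom_altdef)
    then show ?thesis
      using const[of d] by (auto simp: coeff_monom_mult coeff_eq_0)
  qed
  have g_eq: "g_poly d l = (if l \<le> d then of_real (1 / fact l) * coeff (fps_nth (A ^ l) d) 0 else 0)" for d l
    by (simp add: g_poly_def fps_compose_nth exp_series_def coeff_sum coeff_term if_distrib sum.delta cong: if_cong)
  show ?thesis
  proof (intro fps_ext poly_eqI)
    fix d l
    have "g_poly d 0 = (if d = 0 then 1 else 0)"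
      by (simp add: g_eq)
    moreover have "g_poly d l = 0" if "l > d"
      using that by (simp add: g_eq)
    ultimately show "coeff (fps_nth (exp_series oo rx_series) d) l =
      coeff (fps_nth (1 + Abs_fps (\<lambda>d. \<Sum>l=1..d. Polynomial.monom (g_poly d l) l)) d) l"
      by (auto simp: g_poly_def [symmetric] coeff_sum sum.delta not_le Suc_le_eq)
  qed
qed

definition monomials :: "nat \<Rightarrow> nat \<Rightarrow> real_mpoly set"
  where "monomials d l =
    {prod_list (map var_x is) | is. length is = l \<and> sum_list is = d \<and> (\<forall>i\<in>set is. i \<ge> 1)}"

definition F_space :: "nat \<Rightarrow> nat \<Rightarrow> real_mpoly set"
  where "F_space d l = span (monomials d l)"

text \<open>The list entry with index \<open>i\<close> is the pair \<open>(d\<^bsub>i+1\<^esub>, \<ell>\<^bsub>i+1\<^esub>)\<close>.\<close>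
definition admissible :: "nat \<Rightarrow> nat \<Rightarrow> (nat \<times> nat) list \<Rightarrow> bool"
  where "admissible d l ps \<longleftrightarrow>
    ps \<noteq> [] \<and>
    sum_list (map fst ps) = d \<and> sum_list (map snd ps) = l \<and>
    (\<forall>i. i + 1 < length ps \<longrightarrow> fst (ps ! i) > fst (ps ! (i + 1)) + snd (ps ! i)) \<and>
    fst (last ps) \<ge> snd (last ps) \<and>
    (\<forall>p\<in>set ps. snd p \<ge> 1)"

definition S_set :: "nat \<Rightarrow> nat \<Rightarrow> real_mpoly set"
  where "S_set d l = {prod_list (map (\<lambda>(d', l'). g_poly d' l') ps) | ps. admissible d l ps}"

end

theory Submission
  imports Defs "HOL-Library.Multiset"
begin

text \<open>
  With \<open>A(z) = x\<^sub>1 z + x\<^sub>2 z\<^sup>2 + \<dots>\<close> one has \<open>g(d, \<ell>) = [z\<^sup>d] A(z)\<^sup>\<ell> / \<ell>!\<close>.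

  Spanning: suppose two factors \<open>g(a, \<ell>) g(b, m)\<close> with \<open>a \<ge> b\<close> violate \<open>a > b + \<ell>\<close>, and put
  \<open>\<delta> = a - b\<close>, \<open>L = \<ell> + m\<close>. The series \<open>(A(t z) - A(z))\<^sup>j A(z)\<^bsup>L-j\<^esup>\<close> is divisible by
  \<open>(t - 1)\<^sup>j\<close>, so the moments of order less than \<open>j\<close> of the coefficients of its \<open>z\<^bsup>a+b\<^esup>\<close>-term
  vanish. Modulo products whose degrees lie further apart than \<open>\<delta>\<close>, only \<open>\<delta> + 1\<close> powers of \<open>t\<close>
  remain there, so for \<open>j > \<delta>\<close> all coefficients vanish: \<open>i! (L - i)! g(a, i) g(b, L - i)\<close> is a
  polynomial of degree at most \<open>\<delta>\<close> in \<open>i\<close>. Modulo the products with \<open>i < \<delta>\<close> it has the zeros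
  \<open>0, \<dots>, \<delta> - 1\<close> and \<open>L\<close>, so it is zero. Repeating this exchange terminates and expresses every
  product of \<open>g\<close>'s, in particular every monomial \<open>g(i\<^sub>1, 1) g(i\<^sub>2, 1) \<dots>\<close>, by admissible products.

  Independence: cutting a partition along its Durfee square gives an injection from the admissible
  sequences into the partitions of \<open>d\<close> into \<open>\<ell>\<close> parts, which index the monomial basis.
\<close>

subsection \<open>Alternating sums of coefficients of powers\<close>

lemma power_dvd_pderiv:
  fixes p q :: "'a :: idom poly"
  assumes "p ^ Suc n dvd q"
  shows "p ^ n dvd pderiv q"
proof -
  obtain k where "q = p ^ Suc n * k"
    using assms by (elim dvdE)
  then have "pderiv q = p ^ n * (p * pderiv k + k * smult (of_nat (Suc n)) (pderiv p))"
    by (simp only: pderiv_mult pderiv_power_Suc) (simp add: algebra_simps)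
  then show ?thesis by simp
qed

text \<open>The operator \<open>t d/dt - c\<close> multiplies the coefficient of \<open>t^a\<close>
  by \<open>a - c\<close> and costs at most one factor \<open>t - 1\<close>. After one application
  for each \<open>c \<in> C\<close> such a factor is left, so the value at \<open>t = 1\<close> is
  0.\<close>

lemma moments_eq_0:
  fixes q :: "'a :: idom poly"
  assumes "finite C" and "[:- 1, 1:] ^ j dvd q" and "card C < j" and "degree q \<le> N"
  shows "(\<Sum>a\<le>N. (\<Prod>c\<in>C. of_nat a - of_nat c) * coeff q a) = 0"
  using assms
proof (induction C arbitrary: q j rule: finite_induct)
  case empty
  then have "[:- 1, 1:] dvd q"
    by (metis dvd_power dvd_trans card.empty)
  then have "poly q 1 = 0"
    by (simp add: poly_eq_0_iff_dvd)
  moreover have "poly q 1 = (\<Sum>a\<le>N. coeff q a)"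
    unfolding poly_altdef using empty.prems(3)
    by (simp add: coeff_eq_0 sum.mono_neutral_left)
  ultimately show ?case by simp
next
  case (insert c C)
  define q' where "q' = pCons 0 (pderiv q) - smult (of_nat c) q"
  obtain i where j: "j = Suc i"
    using insert.prems by (cases j) auto
  have coeff_q': "coeff q' a = (of_nat a - of_nat c) * coeff q a" for a
    by (cases a) (simp_all add: q'_def coeff_pderiv algebra_simps)
  have "[:- 1, 1:] ^ i dvd q"
    using insert.prems(1) by (metis j le_imp_power_dvd dvd_trans le_SucI order_refl)
  moreover have "[:- 1, 1:] ^ i dvd pderiv q"
    using insert.prems(1) j power_dvd_pderiv by blast
  then have "[:- 1, 1:] ^ i dvd pCons 0 (pderiv q)"
    using dvd_mult[of _ "pderiv q" "[:0, 1:]"] by simp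
  ultimately have "[:- 1, 1:] ^ i dvd q'"
    unfolding q'_def by (intro dvd_diff dvd_smult)
  moreover have "degree q' \<le> N"
    using insert.prems(3) by (intro degree_le) (simp add: coeff_q' coeff_eq_0)
  moreover have "card C < i"
    using insert j by simp
  ultimately have "(\<Sum>a\<le>N. (\<Prod>c\<in>C. of_nat a - of_nat c) * coeff q' a) = 0"
    by (intro insert.IH)
  then show ?case
    using insert.hyps by (simp add: coeff_q' mult_ac)
qed

lemma fps_nth_power_const_poly:
  fixes f :: "'a :: comm_ring_1 fps"
  shows "fps_nth (Abs_fps (\<lambda>j. [:fps_nth f j:]) ^ i) d = [:fps_nth (f ^ i) d:]"
proof (induction i arbitrary: d)
  case 0
  then show ?case by (simp add: one_pCons)
next
  case (Suc i)
  have "(\<Sum>k\<in>A. [:h k:]) = [:\<Sum>k\<in>A. h k:]" for A and h :: "nat \<Rightarrow> 'a"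
    by (induction A rule: infinite_finite_induct) auto
  then show ?case by (simp add: fps_mult_nth Suc.IH mult.commute)
qed

lemma fps_nth_power_monom:
  fixes f :: "'a :: comm_ring_1 fps"
  shows "fps_nth (Abs_fps (\<lambda>j. monom (fps_nth f j) j) ^ i) d = monom (fps_nth (f ^ i) d) d"
proof (induction i arbitrary: d)
  case 0
  then show ?case by simp
next
  case (Suc i)
  have "(\<Sum>k\<in>A. monom (h k) d) = monom (\<Sum>k\<in>A. h k) d" for A and h :: "nat \<Rightarrow> 'a"
    by (induction A rule: infinite_finite_induct) (auto simp: add_monom)
  then show ?case by (simp add: fps_mult_nth Suc.IH mult_monom)
qed

lemma monom_minus_const_dvd:
  fixes a :: "'a :: comm_ring_1"
  shows "[:- 1, 1:] dvd monom a d - [:a:]"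
  by (simp add: dvd_iff_poly_eq_0 poly_monom)

text \<open>By the binomial theorem, the inner sum is the coefficient at \<open>t^a\<close> of the
  \<open>z^N\<close>-term of \<open>(f(t z) - f(z))^j f(z)^(L - j)\<close>, to which
  \<open>moments_eq_0\<close> applies.\<close>

lemma alternating_moments_eq_0:
  fixes f :: "'a :: idom fps"
  assumes "j \<le> L" and "finite C" and "card C < j"
  shows "(\<Sum>a\<le>N. (\<Prod>c\<in>C. of_nat a - of_nat c) *
            (\<Sum>i\<le>j. (- 1) ^ (j - i) * of_nat (j choose i) *
               (fps_nth (f ^ i) a * fps_nth (f ^ (L - i)) (N - a)))) = 0"
proof -
  define f0 where "f0 = Abs_fps (\<lambda>j. [:fps_nth f j:])"
  define f1 where "f1 = Abs_fps (\<lambda>j. monom (fps_nth f j) j)"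
  \<comment> \<open>With the polynomial variable called \<open>t\<close>, these are \<open>f(z)\<close> and \<open>f(t z)\<close>.\<close>
  define q where "q = fps_nth ((f1 + - f0) ^ j * f0 ^ (L - j)) N"
  \<comment> \<open>Choosing all cofactors at once lets \<open>t - 1\<close> be pulled out of the
    series as a constant.\<close>
  have "\<forall>d. \<exists>k. monom (fps_nth f d) d - [:fps_nth f d:] = [:- 1, 1:] * k"
    using monom_minus_const_dvd unfolding dvd_def by blast
  from choice [OF this] obtain h
    where h: "\<forall>d. monom (fps_nth f d) d - [:fps_nth f d:] = [:- 1, 1:] * h d" ..
  have "f1 + - f0 = fps_const [:- 1, 1:] * Abs_fps h"
    by (rule fps_ext)
      (simp only: f1_def f0_def fps_mult_left_const_nth fps_sub_nth fps_nth_Abs_fps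
        add_uminus_conv_diff h [rule_format])
  then have dvd: "[:- 1, 1:] ^ j dvd q"
    by (simp add: q_def power_mult_distrib fps_const_power mult.assoc)
  have split: "(f1 + - f0) ^ j * f0 ^ (L - j) =
      (\<Sum>i\<le>j. fps_const ((- 1) ^ (j - i) * of_nat (j choose i)) * (f1 ^ i * f0 ^ (L - i)))"
  proof -
    have summand: "of_nat (j choose i) * f1 ^ i * (- f0) ^ (j - i) * f0 ^ (L - j) =
        fps_const ((- 1) ^ (j - i) * of_nat (j choose i)) * (f1 ^ i * f0 ^ (L - i))"
      if "i \<le> j" for i
    proof -
      have "f0 ^ (L - i) = f0 ^ (j - i) * f0 ^ (L - j)"
        using that assms(1) by (simp flip: power_add)
      moreover have "(- f0) ^ (j - i) = (- 1) ^ (j - i) * f0 ^ (j - i)"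
        by (rule power_minus)
      moreover have "fps_const ((- 1) ^ (j - i) * of_nat (j choose i) :: 'a poly) =
          (- 1) ^ (j - i) * of_nat (j choose i)"
        by (simp flip: fps_const_mult fps_const_power fps_const_neg fps_of_nat)
      ultimately show ?thesis by (simp add: mult_ac)
    qed
    show ?thesis
      unfolding binomial_ring sum_distrib_right by (intro sum.cong refl summand) simp
  qed
  have "q = (\<Sum>i\<le>j. \<Sum>a\<le>N. (- 1) ^ (j - i) * of_nat (j choose i) *
      (monom (fps_nth (f ^ i) a) a * [:fps_nth (f ^ (L - i)) (N - a):]))"
    unfolding q_def split
    unfolding fps_sum_nth fps_mult_left_const_nth
    unfolding fps_mult_nth sum_distrib_left f0_def f1_def fps_nth_power_const_poly
      fps_nth_power_monom atLeast0AtMost ..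
  also have "\<dots> = (\<Sum>a\<le>N. \<Sum>i\<le>j. monom ((- 1) ^ (j - i) * of_nat (j choose i) *
      (fps_nth (f ^ i) a * fps_nth (f ^ (L - i)) (N - a))) a)"
  proof -
    have "(- 1) ^ k * of_nat n * (monom u a * [:v:]) = monom ((- 1) ^ k * of_nat n * (u * v)) a"
      for k n a and u v :: 'a
      by (cases "even k") (simp_all add: of_nat_poly smult_monom minus_monom mult_ac)
    then show ?thesis by (subst sum.swap) simp
  qed
  also have "\<dots> = (\<Sum>a\<le>N. monom (\<Sum>i\<le>j. (- 1) ^ (j - i) * of_nat (j choose i) *
      (fps_nth (f ^ i) a * fps_nth (f ^ (L - i)) (N - a))) a)"
    by (simp add: monom_sum)
  finally have q: "q = (\<Sum>a\<le>N. monom (\<Sum>i\<le>j. (- 1) ^ (j - i) * of_nat (j choose i) *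
      (fps_nth (f ^ i) a * fps_nth (f ^ (L - i)) (N - a))) a)" .
  have "degree q \<le> N"
    unfolding q by (rule degree_sum_le) (auto intro: order_trans[OF degree_monom_le])
  from moments_eq_0[OF assms(2) dvd assms(3) this] show ?thesis
    by (simp add: q coeff_sum)
qed

text \<open>\<open>i choose m\<close> is a polynomial of degree \<open>m < n\<close> in
  \<open>i\<close>, so its \<open>n\<close>-th difference vanishes. The product of the two binomials
  is rewritten to reduce this to an alternating row sum.\<close>

lemma alternating_choose_mult_choose:
  assumes "m < n"
  shows "(\<Sum>i\<le>n. (- 1) ^ (n - i) * of_nat (n choose i) * of_nat (i choose m)) = (0 :: 'a :: comm_ring_1)"
proof -
  have "(\<Sum>i\<le>n. (- 1) ^ (n - i) * of_nat (n choose i) * of_nat (i choose m)) =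
      (\<Sum>i\<in>{m..n}. (- 1) ^ (n - i) * of_nat (n choose i) * of_nat (i choose m) :: 'a)"
    by (rule sum.mono_neutral_right) (auto simp: not_le binomial_eq_0)
  also have "\<dots> = (\<Sum>i\<in>{m..n}. of_nat (n choose m) * ((- 1) ^ (n - i) * of_nat ((n - m) choose (n - i))))"
  proof (rule sum.cong)
    fix i assume i: "i \<in> {m..n}"
    have "(n choose i) * (i choose m) = (n choose m) * ((n - m) choose (i - m))"
      using i by (intro choose_mult) auto
    also have "(n - m) choose (i - m) = (n - m) choose (n - i)"
      using i by (subst binomial_symmetric) auto
    finally have "of_nat (n choose i) * of_nat (i choose m) =
        (of_nat (n choose m) * of_nat ((n - m) choose (n - i)) :: 'a)"
      by (metis of_nat_mult)
    then show "(- 1) ^ (n - i) * of_nat (n choose i) * of_nat (i choose m) =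
        of_nat (n choose m) * ((- 1) ^ (n - i) * of_nat ((n - m) choose (n - i)) :: 'a)"
      by (simp add: mult.assoc mult.left_commute [of "of_nat (n choose m)"])
  qed simp
  also have "\<dots> = of_nat (n choose m) * (\<Sum>i\<le>n - m. (- 1) ^ i * of_nat ((n - m) choose i))"
    unfolding sum_distrib_left
    by (rule sum.reindex_bij_witness[of _ "\<lambda>i. n - i" "\<lambda>i. n - i"]) (use assms in auto)
  also have "\<dots> = 0"
    using assms by (simp add: choose_alternating_sum)
  finally show ?thesis .
qed

text \<open>A Newton interpolation: the vanishing differences make \<open>h\<close> a polynomial of degree at most
  \<open>m\<close> on \<open>{0..L}\<close>, and it has the \<open>m + 1\<close> zeros \<open>0, \<dots>, m - 1, L\<close>.\<close>

lemma differences_eq_0_imp_eq_0: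
  fixes h :: "nat \<Rightarrow> real"
  assumes diff: "\<And>j. m < j \<Longrightarrow> j \<le> L \<Longrightarrow> (\<Sum>i\<le>j. (- 1) ^ (j - i) * real (j choose i) * h i) = 0"
    and low: "\<And>i. i < m \<Longrightarrow> i \<le> L \<Longrightarrow> h i = 0" and top: "h L = 0"
    and "i \<le> L"
  shows "h i = 0"
proof -
  \<comment> \<open>Only the term \<open>m\<close> of the Newton expansion survives. As
    \<open>L choose m\<close> is positive for \<open>m \<le> L\<close>, the zero at \<open>L\<close>
    will then kill \<open>h m\<close>.\<close>
  have interpolation: "h i = h m * real (i choose m)" if "i \<le> L" for i
    using that
  proof (induction i rule: less_induct)
    case (less j)
    show ?case
    proof (cases "m < j")
      case True
      \<comment> \<open>Both differences are zero, and by induction their combination has no summand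
        left but the one at \<open>j\<close>.\<close>
      have "0 = (\<Sum>i\<le>j. (- 1) ^ (j - i) * real (j choose i) * h i) -
          h m * (\<Sum>i\<le>j. (- 1) ^ (j - i) * real (j choose i) * real (i choose m))"
        using True less.prems by (simp only: diff alternating_choose_mult_choose)
      also have "\<dots> = (\<Sum>i\<le>j. (- 1) ^ (j - i) * real (j choose i) * (h i - h m * real (i choose m)))"
        by (simp add: sum_distrib_left sum_subtractf algebra_simps)
      also have "\<dots> = (\<Sum>i\<in>{j}. (- 1) ^ (j - i) * real (j choose i) * (h i - h m * real (i choose m)))"
        using less by (intro sum.mono_neutral_right) auto
      finally show ?thesis by simp
    next
      case False
      with less.prems low show ?thesis by (cases "j = m") auto
    qed
  qed
  show ?thesis
  proof (cases "m \<le> L")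
    case True
    then have "h m = 0"
      using interpolation[of L] top by simp
    with interpolation assms(4) show ?thesis by simp
  qed (use low assms(4) in auto)
qed

subsection \<open>The exchange argument\<close>

definition x_series :: "real_mpoly fps"
  where "x_series = Abs_fps (\<lambda>j. if j = 0 then 0 else var_x j)"

lemma x_series_power_nth_eq_0:
  assumes "d < l"
  shows "fps_nth (x_series ^ l) d = 0"
  using startsby_zero_power_prefix [of x_series l] assms by (simp add: x_series_def)

text \<open>The \<open>i\<close>-th term of \<open>exp(r A(z))\<close> carries exactly
  \<open>r^i\<close>, so only \<open>i = l\<close> contributes to the coefficient of
  \<open>r^l\<close>.\<close>

lemma g_poly_conv_x_series: "g_poly d l = (1 / fact l) *\<^sub>R fps_nth (x_series ^ l) d"
proof -
  define A where "A = Abs_fps (\<lambda>j. [:fps_nth x_series j:])"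
  have rx: "rx_series = fps_const [:0, 1:] * A"
    unfolding rx_series_def A_def x_series_def by (intro arg_cong2 [where f = "(*)"] fps_ext) auto
  have nth: "fps_nth (rx_series ^ i) d = monom (fps_nth (x_series ^ i) d) i" for i
    unfolding rx power_mult_distrib fps_const_power fps_mult_left_const_nth
    by (simp add: A_def fps_nth_power_const_poly monom_altdef)
  have "g_poly d l = (\<Sum>i\<le>d. if i = l then of_real (1 / fact i) * fps_nth (x_series ^ i) d else 0)"
    unfolding g_poly_def fps_compose_nth exp_series_def coeff_sum nth atLeast0AtMost
    by (intro sum.cong) auto
  also have "\<dots> = of_real (1 / fact l) * fps_nth (x_series ^ l) d"
    by (cases "l \<le> d") (simp_all add: x_series_power_nth_eq_0)
  finally show ?thesis
    by (simp add: scaleR_conv_of_real)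
qed

lemma g_poly_eq_0: "d < l \<Longrightarrow> g_poly d l = 0"
  by (simp add: g_poly_conv_x_series x_series_power_nth_eq_0)

lemma g_poly_0: "g_poly d 0 = (if d = 0 then 1 else 0)"
  by (simp add: g_poly_conv_x_series)

lemma g_poly_1: "d \<ge> 1 \<Longrightarrow> g_poly d 1 = var_x d"
  by (simp add: g_poly_conv_x_series x_series_def)

lemma x_series_power_nth: "fps_nth (x_series ^ l) d = fact l *\<^sub>R g_poly d l"
  by (simp add: g_poly_conv_x_series)

lemma F_space_mult:
  assumes "p \<in> F_space d l" and "q \<in> F_space d' l'"
  shows "p * q \<in> F_space (d + d') (l + l')"
proof -
  have monomials_mult: "u * v \<in> monomials (d + d') (l + l')"
    if uv: "u \<in> monomials d l" "v \<in> monomials d' l'" for u v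
  proof -
    obtain xs ys where "u = prod_list (map var_x xs)" "length xs = l" "sum_list xs = d" "\<forall>i\<in>set xs. i \<ge> 1"
      and "v = prod_list (map var_x ys)" "length ys = l'" "sum_list ys = d'" "\<forall>i\<in>set ys. i \<ge> 1"
      using uv by (auto simp: monomials_def)
    then show ?thesis
      by (auto simp: monomials_def intro!: exI [of _ "xs @ ys"])
  qed
  have "u * q \<in> F_space (d + d') (l + l')" if u: "u \<in> monomials d l" for u
    using assms(2) unfolding F_space_def
  proof (induction q rule: span_induct_alt)
    case base
    then show ?case by (simp add: span_zero)
  next
    case (step c v q)
    then show ?case
      using monomials_mult [OF u] by (simp add: distrib_left span_add span_scale span_base)
  qed
  with assms(1) show ?thesis
    unfolding F_space_def
  proof (induction p rule: span_induct_alt)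
    case base
    then show ?case by (simp add: span_zero)
  next
    case (step c u p)
    then show ?case
      by (simp add: distrib_right span_add span_scale)
  qed
qed

lemma one_in_F_space: "1 \<in> F_space 0 0"
  unfolding F_space_def by (intro span_base) (auto simp: monomials_def)

lemma var_x_in_F_space: "d \<ge> 1 \<Longrightarrow> var_x d \<in> F_space d 1"
  unfolding F_space_def by (intro span_base) (auto simp: monomials_def intro!: exI [of _ "[d]"])

lemma x_series_power_in_F_space: "fps_nth (x_series ^ l) d \<in> F_space d l"
proof (induction l arbitrary: d)
  case 0
  then show ?case
    using one_in_F_space by (simp add: F_space_def span_zero)
next
  case (Suc l)
  have "fps_nth x_series i * fps_nth (x_series ^ l) (d - i) \<in> F_space d (Suc l)" if "i \<le> d" for i
  proof (cases "i = 0")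
    case True
    then show ?thesis by (simp add: x_series_def F_space_def span_zero)
  next
    case False
    then show ?thesis
      using F_space_mult [OF var_x_in_F_space Suc.IH, of i "d - i"] that by (simp add: x_series_def)
  qed
  then show ?case
    unfolding power_Suc fps_mult_nth F_space_def by (intro span_sum) auto
qed

lemma g_poly_in_F_space: "g_poly d l \<in> F_space d l"
  using x_series_power_in_F_space [of l d]
  unfolding g_poly_conv_x_series F_space_def by (rule span_scale)

lemma g_product_in_F_space:
  "prod_list (map (\<lambda>(d', l'). g_poly d' l') ps) \<in> F_space (sum_list (map fst ps)) (sum_list (map snd ps))"
  by (induction ps) (auto simp: one_in_F_space intro!: F_space_mult g_poly_in_F_space)

lemma S_set_subset_F_space: "S_set d l \<subseteq> F_space d l"
  using g_product_in_F_space by (auto simp: S_set_def admissible_def)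

text \<open>The functional \<open>\<psi>\<close> expresses congruence modulo the products it kills.
  In the moment identity with \<open>C = {b0..<a0}\<close>, \<open>outside\<close> removes
  \<open>a < b0\<close> and \<open>a > a0\<close>, and the product over \<open>C\<close> removes
  \<open>b0 \<le> a < a0\<close>. Only \<open>a = a0\<close> is left, with nonzero weight, so the
  differences of order above \<open>a0 - b0\<close> vanish and interpolation applies.\<close>

lemma exchange_window:
  fixes \<psi> :: "real_mpoly \<Rightarrow> real"
  assumes "linear \<psi>" and "b0 \<ge> 1" and "b0 \<le> a0"
    and outside: "\<And>a i. a \<le> a0 + b0 \<Longrightarrow> a < b0 \<or> a0 < a \<Longrightarrow> i \<le> L \<Longrightarrow>
      \<psi> (g_poly a i * g_poly (a0 + b0 - a) (L - i)) = 0"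
    and low: "\<And>i. i < a0 - b0 \<Longrightarrow> i \<le> L \<Longrightarrow> \<psi> (g_poly a0 i * g_poly b0 (L - i)) = 0"
    and "L \<ge> 1" and "i \<le> L"
  shows "\<psi> (g_poly a0 i * g_poly b0 (L - i)) = 0"
proof -
  interpret linear \<psi> by fact
  define h where
    "h a i = \<psi> (fps_nth (x_series ^ i) a * fps_nth (x_series ^ (L - i)) (a0 + b0 - a))" for a i
  have h: "h a i = fact i * fact (L - i) * \<psi> (g_poly a i * g_poly (a0 + b0 - a) (L - i))" for a i
    by (simp add: h_def x_series_power_nth scale)
  have "h a0 i = 0"
  proof (rule differences_eq_0_imp_eq_0 [where m = "a0 - b0" and L = L])
    fix j assume j: "a0 - b0 < j" "j \<le> L"
    have "0 = \<psi> (\<Sum>a\<le>a0 + b0. (\<Prod>c\<in>{b0..<a0}. of_nat a - of_nat c) *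
            (\<Sum>i\<le>j. (- 1) ^ (j - i) * of_nat (j choose i) *
               (fps_nth (x_series ^ i) a * fps_nth (x_series ^ (L - i)) (a0 + b0 - a))))"
      using j by (subst alternating_moments_eq_0) (simp_all add: zero)
    also have "\<dots> = \<psi> (\<Sum>a\<le>a0 + b0. (\<Prod>c\<in>{b0..<a0}. real a - real c) *\<^sub>R
            (\<Sum>i\<le>j. ((- 1) ^ (j - i) * real (j choose i)) *\<^sub>R
               (fps_nth (x_series ^ i) a * fps_nth (x_series ^ (L - i)) (a0 + b0 - a))))"
      by (simp only: scaleR_conv_of_real of_real_prod of_real_diff of_real_of_nat_eq of_real_mult
            of_real_power of_real_minus of_real_1)
    also have "\<dots> = (\<Sum>a\<le>a0 + b0. (\<Prod>c\<in>{b0..<a0}. real a - real c) *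
            (\<Sum>i\<le>j. (- 1) ^ (j - i) * real (j choose i) * h a i))"
      by (simp only: sum scale h_def real_scaleR_def)
    also have "\<dots> = (\<Sum>a\<in>{a0}. (\<Prod>c\<in>{b0..<a0}. real a - real c) *
            (\<Sum>i\<le>j. (- 1) ^ (j - i) * real (j choose i) * h a i))"
    proof (rule sum.mono_neutral_right)
      show "\<forall>a\<in>{..a0 + b0} - {a0}. (\<Prod>c\<in>{b0..<a0}. real a - real c) *
            (\<Sum>i\<le>j. (- 1) ^ (j - i) * real (j choose i) * h a i) = 0"
      proof
        fix a assume a: "a \<in> {..a0 + b0} - {a0}"
        show "(\<Prod>c\<in>{b0..<a0}. real a - real c) *
            (\<Sum>i\<le>j. (- 1) ^ (j - i) * real (j choose i) * h a i) = 0"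
        proof (cases "b0 \<le> a \<and> a < a0")
          case True
          then have "(\<Prod>c\<in>{b0..<a0}. real a - real c) = 0"
            by (intro prod_zero) auto
          then show ?thesis by simp
        next
          case False
          then have "h a i = 0" if "i \<le> j" for i
            using a that j outside [of a i] by (auto simp: h)
          then show ?thesis by simp
        qed
      qed
    qed auto
    finally show "(\<Sum>i\<le>j. (- 1) ^ (j - i) * real (j choose i) * h a0 i) = 0"
      by simp
  next
    \<comment> \<open>The additional zero: here the second factor is \<open>g_poly b0 0\<close>,
      which is 0 for \<open>b0 \<ge> 1\<close>.\<close>
    show "h a0 L = 0"
      using \<open>b0 \<ge> 1\<close> by (simp add: h g_poly_0 zero)
  qed (use low \<open>i \<le> L\<close> in \<open>simp_all add: h\<close>)
  then show ?thesis
    by (simp add: h)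
qed

section \<open>Reduction of all products to admissible ones\<close>

abbreviation g_mset :: "(nat \<times> nat) multiset \<Rightarrow> real_mpoly"
  where "g_mset M \<equiv> (\<Prod>p\<in>#M. g_poly (fst p) (snd p))"

text \<open>Bounds the sum of squared degrees by \<open>d^2\<close>, so that the truncated
  difference in the termination measure strictly falls when the squares grow.\<close>

lemma sum_mset_square_le: "(\<Sum>p\<in>#M. (f p)\<^sup>2) \<le> (\<Sum>p\<in>#M. f p :: nat)\<^sup>2"
  by (induction M) (auto simp: power2_sum)

lemma mset_split_adjacent:
  assumes "i + 1 < length xs"
  shows "mset xs = {#xs ! i, xs ! (i + 1)#} + mset (take i xs @ drop (i + 2) xs)"
proof -
  have "xs = take i xs @ xs ! i # xs ! (i + 1) # drop (i + 2) xs"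
    using assms by (simp add: Cons_nth_drop_Suc flip: id_take_nth_drop)
  then have "mset xs = mset (take i xs @ xs ! i # xs ! (i + 1) # drop (i + 2) xs)"
    by (rule arg_cong)
  then show ?thesis by simp
qed

text \<open>The induction moves a violating pair of degrees further apart, and for fixed degrees moves
  length from the factor of larger degree to the one of smaller degree.\<close>

lemma functional_g_mset_eq_0:
  fixes \<phi> :: "real_mpoly \<Rightarrow> real"
  assumes "linear \<phi>" and S: "\<And>p. p \<in> S_set d l \<Longrightarrow> \<phi> p = 0" and "l \<ge> 1"
    and "\<forall>p\<in>#M. snd p \<ge> 1" and "(\<Sum>p\<in>#M. fst p) = d" and "(\<Sum>p\<in>#M. snd p) = l"
  shows "\<phi> (g_mset M) = 0"
  using assms(4-)
proof (induction M rule: wf_induct_rule [OF wf_measures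
    [of "[\<lambda>M. d\<^sup>2 - (\<Sum>p\<in>#M. (fst p)\<^sup>2), \<lambda>M. \<Sum>p\<in>#M. fst p * snd p]"]])
  case (1 M)
  interpret linear \<phi> by fact
  show ?case
  proof (cases "\<exists>p\<in>#M. fst p < snd p")
    case True
    then have "0 \<in># image_mset (\<lambda>p. g_poly (fst p) (snd p)) M"
      by (auto simp: g_poly_eq_0 intro!: rev_image_eqI)
    then have "g_mset M = 0"
      by (simp only: prod_mset_zero_iff)
    then show ?thesis
      by (simp only: zero)
  next
    case False
    obtain xs where xs: "mset xs = M"
      using ex_mset by blast
    \<comment> \<open>In decreasing order of degrees, a violation of the spacing shows at two
      neighbours.\<close>
    define qs where "qs = rev (sort_key fst xs)"
    have mset_qs: "mset qs = M"
      by (simp add: qs_def xs)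
    have antimono: "fst (qs ! (i + 1)) \<le> fst (qs ! i)" if "i + 1 < length qs" for i
    proof -
      have "sorted (rev (map fst qs))"
        by (simp add: qs_def rev_map)
      then show ?thesis
        using that sorted_rev_nth_mono [of "map fst qs" i "i + 1"] by simp
    qed
    show ?thesis
    proof (cases "\<forall>i. i + 1 < length qs \<longrightarrow> fst (qs ! i) > fst (qs ! (i + 1)) + snd (qs ! i)")
      case True
      have "qs \<noteq> []"
        using 1(4) \<open>l \<ge> 1\<close> mset_qs by auto
      moreover have "sum_list (map fst qs) = d" "sum_list (map snd qs) = l"
        using 1(3,4) by (simp_all add: mset_qs flip: sum_mset_sum_list)
      moreover have "\<forall>p\<in>set qs. fst p \<ge> snd p" "\<forall>p\<in>set qs. snd p \<ge> 1"
        using False 1(2) mset_qs by (auto simp: not_less simp flip: set_mset_mset)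
      ultimately have "admissible d l qs"
        using True by (simp add: admissible_def)
      moreover have "g_mset M = prod_list (map (\<lambda>(d', l'). g_poly d' l') qs)"
        by (simp add: case_prod_unfold mset_qs flip: prod_mset_prod_list)
      ultimately have "g_mset M \<in> S_set d l"
        by (auto simp: S_set_def)
      then show ?thesis by (rule S)
    next
      case False
      then obtain i where i: "i + 1 < length qs" "fst (qs ! i) \<le> fst (qs ! (i + 1)) + snd (qs ! i)"
        by (auto simp: not_less)
      obtain a0 l0 where p: "qs ! i = (a0, l0)" by fastforce
      obtain b0 m0 where q: "qs ! (i + 1) = (b0, m0)" by fastforce
      define R where "R = mset (take i qs @ drop (i + 2) qs)"
      have M: "M = {#(a0, l0), (b0, m0)#} + R"
        using mset_split_adjacent [OF i(1)] by (simp only: R_def p q mset_qs)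
      have ab: "b0 \<le> a0" "a0 \<le> b0 + l0"
        using antimono [OF i(1)] i(2) by (simp_all only: p q fst_conv snd_conv)
      have pos: "l0 \<ge> 1" "m0 \<ge> 1"
        using 1(2) by (simp_all add: M)
      have "m0 \<le> b0"
        using \<open>\<not> (\<exists>p\<in>#M. fst p < snd p)\<close> by (simp add: M)
      then have "b0 \<ge> 1"
        using pos by simp
      define \<psi> where "\<psi> p = \<phi> (p * g_mset R)" for p
      have "linear \<psi>"
        by (rule linearI) (simp_all add: \<psi>_def distrib_right add scale)
      have bound: "(\<Sum>p\<in>#M'. (fst p)\<^sup>2) \<le> d\<^sup>2" if "(\<Sum>p\<in>#M'. fst p) = d" for M' :: "(nat \<times> nat) multiset"
        using sum_mset_square_le [of fst M'] that by simp
      have pair: "\<psi> (g_poly a i * g_poly b m) = 0"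
        if "a + b = a0 + b0" "i + m = l0 + m0" "i \<ge> 1" "m \<ge> 1"
          and less: "a\<^sup>2 + b\<^sup>2 > a0\<^sup>2 + b0\<^sup>2 \<or> a = a0 \<and> b = b0 \<and> a * i + b * m < a0 * l0 + b0 * m0" for a b i m
      proof -
        define M' where "M' = {#(a, i), (b, m)#} + R"
        have M': "\<forall>p\<in>#M'. snd p \<ge> 1" "(\<Sum>p\<in>#M'. fst p) = d" "(\<Sum>p\<in>#M'. snd p) = l"
          using that 1(2-4) by (auto simp: M M'_def)
        have "\<phi> (g_mset M') = 0"
          using less bound [OF M'(2)] M' by (intro 1(1)) (auto simp: M M'_def)
        then show ?thesis
          by (simp add: \<psi>_def M'_def mult.assoc)
      qed
      \<comment> \<open>When one factor is \<open>g_poly 0 0 = 1\<close>, the pair collapses to this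
        single factor. Merging increases the sum of squares, so the induction hypothesis covers
        it.\<close>
      have merged: "\<psi> (g_poly (a0 + b0) (l0 + m0)) = 0"
      proof -
        define M' where "M' = {#(a0 + b0, l0 + m0)#} + R"
        have M': "\<forall>p\<in>#M'. snd p \<ge> 1" "(\<Sum>p\<in>#M'. fst p) = d" "(\<Sum>p\<in>#M'. snd p) = l"
          using pos 1(2-4) by (auto simp: M M'_def)
        have "a0\<^sup>2 + b0\<^sup>2 < (a0 + b0)\<^sup>2"
          using \<open>b0 \<ge> 1\<close> ab by (simp add: power2_sum)
        then have "\<phi> (g_mset M') = 0"
          using bound [OF M'(2)] M' by (intro 1(1)) (auto simp: M M'_def)
        then show ?thesis
          by (simp add: \<psi>_def M'_def)
      qed
      have "\<psi> (g_poly a0 l0 * g_poly b0 (l0 + m0 - l0)) = 0"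
      proof (rule exchange_window [OF \<open>linear \<psi>\<close> \<open>b0 \<ge> 1\<close> \<open>b0 \<le> a0\<close>])
        fix a i assume a: "a \<le> a0 + b0" "a < b0 \<or> a0 < a" and "i \<le> l0 + m0"
        then consider "i = 0" | "i = l0 + m0" | "i \<ge> 1" "l0 + m0 - i \<ge> 1"
          by linarith
        then show "\<psi> (g_poly a i * g_poly (a0 + b0 - a) (l0 + m0 - i)) = 0"
        proof cases
          case 3
          define b where "b = a0 + b0 - a"
          have b: "int b = int a0 + int b0 - int a"
            using a by (simp add: b_def)
          \<comment> \<open>For \<open>a\<close> outside the interval from \<open>b0\<close> to
            \<open>a0\<close> both factors have the same sign; twice their product is the gain in
            the sum of squares.\<close>
          have "0 < (int a - int b0) * (int a - int a0)"
            using a ab by (auto intro: mult_pos_pos mult_neg_neg)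
          moreover have "2 * ((int a - int b0) * (int a - int a0)) =
              int (a\<^sup>2 + b\<^sup>2) - int (a0\<^sup>2 + b0\<^sup>2)"
            by (simp add: b power2_eq_square algebra_simps)
          ultimately have "a0\<^sup>2 + b0\<^sup>2 < a\<^sup>2 + b\<^sup>2"
            by linarith
          with 3 a show ?thesis
            by (intro pair) (auto simp: b_def)
        qed (use merged \<open>linear \<psi>\<close> a in \<open>auto simp: g_poly_0 linear_0\<close>)
      next
        fix i assume i: "i < a0 - b0" "i \<le> l0 + m0"
        show "\<psi> (g_poly a0 i * g_poly b0 (l0 + m0 - i)) = 0"
        proof (cases "i = 0")
          case True
          then show ?thesis
            using \<open>b0 \<ge> 1\<close> ab \<open>linear \<psi>\<close> by (simp add: g_poly_0 linear_0)
        next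
          case False
          \<comment> \<open>The violation \<open>a0 \<le> b0 + l0\<close> gives
            \<open>i < l0\<close>, so a positive length \<open>e\<close> moves from degree
            \<open>a0\<close> to the smaller degree \<open>b0\<close>.\<close>
          define e where "e = l0 - i"
          have e: "l0 = i + e" "e \<ge> 1"
            using i ab by (auto simp: e_def)
          have "b0 * e < a0 * e"
            using i e by simp
          then show ?thesis
            using False i e pos by (intro pair) (auto simp: algebra_simps)
        qed
      qed (use pos in auto)
      then show ?thesis
        by (simp add: \<psi>_def M mult.assoc)
    qed
  qed
qed

subsection \<open>Durfee squares\<close>

text \<open>Admissibility freed of the totals and extended to the empty list, so that it passes to
  tails.\<close>

definition spaced :: "(nat \<times> nat) list \<Rightarrow> bool"
  where "spaced ps \<longleftrightarrow> successively (\<lambda>p q. fst q + snd p < fst p) ps \<and>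
    (ps \<noteq> [] \<longrightarrow> snd (last ps) \<le> fst (last ps)) \<and> (\<forall>p\<in>set ps. 1 \<le> snd p)"

lemma spaced_Nil [simp]: "spaced []"
  by (simp add: spaced_def)

lemma spaced_Cons: "spaced (p # ps) \<longleftrightarrow>
    (if ps = [] then snd p \<le> fst p else fst (hd ps) + snd p < fst p) \<and> 1 \<le> snd p \<and> spaced ps"
  by (cases ps) (auto simp: spaced_def)

lemma admissible_iff_spaced:
  "admissible d l ps \<longleftrightarrow>
    ps \<noteq> [] \<and> spaced ps \<and> sum_list (map fst ps) = d \<and> sum_list (map snd ps) = l"
  by (auto simp: admissible_def spaced_def successively_conv_nth add.commute)

text \<open>Chain \<open>d_i \<ge> d_(i+1) + l_i + 1\<close> down to \<open>d_k \<ge> l_k\<close>.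
  This keeps the subtraction in \<open>durfee_rows\<close> from being truncated.\<close>

lemma spaced_hd_ge:
  assumes "spaced ps" and "ps \<noteq> []"
  shows "sum_list (map snd ps) + length ps \<le> fst (hd ps) + 1"
  using assms by (induction ps) (auto simp: spaced_Cons split: if_splits)

text \<open>A partition is cut along its Durfee square of side \<open>k\<close>: \<open>durfee_rows\<close> are its first \<open>k\<close>
  parts, \<open>durfee_rest\<close> the other ones. The offset \<open>j\<close> is the number of the first row.\<close>

fun durfee_rows :: "nat \<Rightarrow> (nat \<times> nat) list \<Rightarrow> nat list"
  where
    "durfee_rows j [] = []"
  | "durfee_rows j (p # ps) = (fst p + j - sum_list (map snd (p # ps))) # durfee_rows (Suc j) ps"

fun durfee_rest :: "nat \<Rightarrow> (nat \<times> nat) list \<Rightarrow> nat list"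
  where
    "durfee_rest j [] = []"
  | "durfee_rest j (p # ps) = durfee_rest (Suc j) ps @ replicate (snd p - 1) j"

lemma length_durfee_rows [simp]: "length (durfee_rows j ps) = length ps"
  by (induction ps arbitrary: j) auto

text \<open>For \<open>j = 1\<close> the rows have size at least \<open>k = length ps\<close>. As
  \<open>durfee_rest_bounds\<close> keeps the other parts at most \<open>k\<close>, the square of
  side \<open>k\<close> is the Durfee square.\<close>

lemma durfee_rows_ge: "spaced ps \<Longrightarrow> x \<in> set (durfee_rows j ps) \<Longrightarrow> j + length ps \<le> Suc x"
proof (induction ps arbitrary: j)
  case (Cons p ps)
  show ?case
  proof (cases "x \<in> set (durfee_rows (Suc j) ps)")
    case True
    then show ?thesis
      using Cons.IH [of "Suc j"] Cons.prems(1) by (simp add: spaced_Cons)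
  next
    case False
    then show ?thesis
      using Cons.prems spaced_hd_ge [of "p # ps"] by simp
  qed
qed simp

lemma durfee_rest_bounds: "x \<in> set (durfee_rest j ps) \<Longrightarrow> j \<le> x \<and> x < j + length ps"
proof (induction ps arbitrary: j)
  case (Cons p ps)
  then show ?case
    using Cons.IH [of "Suc j"] by fastforce
qed simp

text \<open>Consecutive rows differ by \<open>d_i - d_(i+1) - l_i - 1\<close>, so the spacing
  condition is exactly their weak decrease.\<close>

lemma sorted_durfee_rows: "spaced ps \<Longrightarrow> sorted_wrt (\<ge>) (durfee_rows j ps)"
proof (induction ps arbitrary: j)
  case (Cons p ps)
  show ?case
  proof (cases ps)
    case (Cons q qs)
    have "spaced ps" "fst q + snd p < fst p"
      using Cons.prems by (simp_all add: spaced_Cons Cons)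
    moreover have "sum_list (map snd ps) \<le> fst q"
      using spaced_hd_ge [OF \<open>spaced ps\<close>] Cons by simp
    ultimately show ?thesis
      using Cons.IH [of "Suc j"] by (auto simp: Cons)
  qed simp
qed simp

lemma sorted_durfee_rest: "sorted_wrt (\<ge>) (durfee_rest j ps)"
proof (induction ps arbitrary: j)
  case (Cons p ps)
  have "sorted_wrt (\<ge>) (replicate n j)" for n
    by (simp add: sorted_wrt_iff_nth_less)
  moreover have "j \<le> x" if "x \<in> set (durfee_rest (Suc j) ps)" for x
    using durfee_rest_bounds [OF that] by simp
  ultimately show ?case
    using Cons.IH [of "Suc j"] by (auto simp: sorted_wrt_append)
qed simp

lemma length_durfee: "spaced ps \<Longrightarrow>
    length (durfee_rows j ps @ durfee_rest j ps) = sum_list (map snd ps)"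
proof (induction ps arbitrary: j)
  case (Cons p ps)
  then show ?case
    using Cons.IH [of "Suc j"] by (simp add: spaced_Cons)
qed simp

text \<open>The rows up to the \<open>m\<close>-th each subtract \<open>l_m\<close>, while row
  \<open>m\<close> and the copies in the rest contribute their offset \<open>l_m\<close> times. The
  net gain is \<open>j - 1\<close> times the total length, hence none for
  \<open>j = 1\<close>.\<close>

lemma sum_durfee: "spaced ps \<Longrightarrow>
    sum_list (durfee_rows j ps @ durfee_rest j ps) + sum_list (map snd ps) =
    sum_list (map fst ps) + j * sum_list (map snd ps)"
proof (induction ps arbitrary: j)
  case (Cons p ps)
  obtain m where m: "snd p = Suc m"
    using Cons.prems by (cases "snd p") (auto simp: spaced_Cons)
  show ?case
    using Cons.IH [of "Suc j"] Cons.prems spaced_hd_ge [OF Cons.prems]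
    by (simp add: spaced_Cons m sum_list_replicate algebra_simps)
qed simp

text \<open>The tail contributes only values above \<open>j\<close> to the rest, so the multiplicity
  of \<open>j\<close> there recovers \<open>snd p\<close>; the first row then gives
  \<open>fst p\<close>.\<close>

lemma durfee_inject:
  assumes "spaced ps" and "spaced qs" and "durfee_rows j ps = durfee_rows j qs"
    and "durfee_rest j ps = durfee_rest j qs"
  shows "ps = qs"
  using assms
proof (induction ps arbitrary: j qs)
  case Nil
  then show ?case by (cases qs) auto
next
  case (Cons p ps)
  obtain q qs' where qs: "qs = q # qs'"
    using Cons.prems(3) by (cases qs) auto
  have count: "count_list (durfee_rest j (r # rs)) j = snd r - 1" for r and rs :: "(nat \<times> nat) list"
  proof -
    have "count_list (replicate n j) j = n" for n
      by (induction n) auto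
    then show ?thesis
      using durfee_rest_bounds [of j "Suc j" rs] by (auto simp: count_list_0_iff)
  qed
  have "snd p - 1 = snd q - 1"
    using count [of p ps] count [of q qs'] Cons.prems(4) by (simp only: qs)
  moreover have "1 \<le> snd p" "1 \<le> snd q"
    using Cons.prems(1,2) by (simp_all add: qs spaced_Cons)
  ultimately have snd: "snd p = snd q"
    by linarith
  have "ps = qs'"
    using Cons.prems by (intro Cons.IH [of qs' "Suc j"]) (simp_all add: qs spaced_Cons snd)
  moreover have "fst p = fst q"
    using Cons.prems(3) spaced_hd_ge [OF Cons.prems(1)] spaced_hd_ge [OF Cons.prems(2)]
    by (simp add: qs snd \<open>ps = qs'\<close>)
  ultimately show ?case
    using snd by (simp add: qs prod_eq_iff)
qed

definition durfee :: "(nat \<times> nat) list \<Rightarrow> nat list"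
  where "durfee ps = durfee_rows 1 ps @ durfee_rest 1 ps"

lemma sorted_durfee:
  assumes "spaced ps"
  shows "sorted_wrt (\<ge>) (durfee ps)"
proof -
  have "y \<le> x" if "x \<in> set (durfee_rows 1 ps)" "y \<in> set (durfee_rest 1 ps)" for x y
    using durfee_rows_ge [OF assms that(1)] durfee_rest_bounds [OF that(2)] by simp
  then show ?thesis
    using assms by (auto simp: durfee_def sorted_wrt_append sorted_durfee_rows sorted_durfee_rest)
qed

text \<open>If \<open>qs\<close> were longer, the entry at index \<open>length ps\<close> would be a
  row for \<open>qs\<close>, so at least \<open>length qs\<close>, but in the rest for
  \<open>ps\<close>, so at most \<open>length ps\<close>.\<close>

lemma length_le_if_durfee_eq:
  assumes "spaced ps" and "spaced qs" and "durfee ps = durfee qs"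
  shows "length qs \<le> length ps"
proof (rule ccontr)
  assume less: "\<not> length qs \<le> length ps"
  define x where "x = durfee qs ! length ps"
  have "x \<in> set (durfee_rows 1 qs)"
    using less by (simp add: x_def durfee_def nth_append)
  then have "length qs \<le> x"
    using durfee_rows_ge [OF assms(2), of x 1] by simp
  moreover have "length ps < length (durfee ps)"
    using less unfolding assms(3) by (simp add: durfee_def)
  then have "x \<in> set (durfee_rest 1 ps)"
    unfolding x_def assms(3) [symmetric] by (simp add: durfee_def nth_append)
  then have "x \<le> length ps"
    using durfee_rest_bounds [of x 1 ps] by simp
  ultimately show False
    using less by simp
qed

lemma inj_on_mset_durfee: "inj_on (\<lambda>ps. mset (durfee ps)) {ps. spaced ps}"
proof (rule inj_onI)
  fix ps qs assume "ps \<in> {ps. spaced ps}" "qs \<in> {ps. spaced ps}"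
    and mset: "mset (durfee ps) = mset (durfee qs)"
  then have *: "spaced ps" "spaced qs" by simp_all
  have "sort (durfee qs) = rev (durfee ps)"
    using * mset by (intro properties_for_sort) (simp_all add: sorted_wrt_rev sorted_durfee)
  moreover have "sort (durfee qs) = rev (durfee qs)"
    using * by (intro properties_for_sort) (simp_all add: sorted_wrt_rev sorted_durfee)
  ultimately have "rev (durfee ps) = rev (durfee qs)" by simp
  then have eq: "durfee ps = durfee qs" by simp
  then have "length ps = length qs"
    using length_le_if_durfee_eq * by (metis order_antisym)
  with eq show "ps = qs"
    using * by (intro durfee_inject [where j = 1]) (auto simp: durfee_def)
qed

section \<open>Counting admissible sequences by partitions\<close>

definition partitions :: "nat \<Rightarrow> nat \<Rightarrow> nat multiset set"
  where "partitions d l = {M. size M = l \<and> sum_mset M = d \<and> (\<forall>x\<in>#M. 1 \<le> x)}"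

lemma finite_partitions: "finite (partitions d l)"
proof (rule finite_subset)
  show "partitions d l \<subseteq> mset ` {xs. set xs \<subseteq> {..d} \<and> length xs = l}"
  proof
    fix M assume M: "M \<in> partitions d l"
    obtain xs where xs: "mset xs = M"
      using ex_mset by blast
    then have "length xs = l" "sum_list xs = d"
      using M by (auto simp: partitions_def sum_mset_sum_list)
    then have "set xs \<subseteq> {..d}"
      using member_le_sum_list [of _ xs] by auto
    with xs \<open>length xs = l\<close> show "M \<in> mset ` {xs. set xs \<subseteq> {..d} \<and> length xs = l}"
      by blast
  qed
  show "finite (mset ` {xs. set xs \<subseteq> {..d} \<and> length xs = l})"
    by (simp add: finite_lists_length_eq)
qed

lemma mset_durfee_in_partitions:
  assumes "admissible d l ps"
  shows "mset (durfee ps) \<in> partitions d l"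
proof -
  have ps: "spaced ps" "sum_list (map fst ps) = d" "sum_list (map snd ps) = l"
    using assms by (simp_all add: admissible_iff_spaced)
  have "1 \<le> x" if "x \<in> set (durfee ps)" for x
    using that durfee_rows_ge [OF ps(1), of x 1] durfee_rest_bounds [of x 1 ps]
    by (cases ps) (auto simp: durfee_def)
  moreover have "length (durfee ps) = l"
    using length_durfee [OF ps(1)] ps by (simp add: durfee_def)
  moreover have "sum_list (durfee ps) = d"
    using sum_durfee [OF ps(1), of 1] ps by (simp add: durfee_def)
  ultimately show ?thesis
    by (simp add: partitions_def sum_mset_sum_list)
qed

lemma card_admissible_le: "finite {ps. admissible d l ps} \<and>
    card {ps. admissible d l ps} \<le> card (partitions d l)"
proof -
  have inj: "inj_on (\<lambda>ps. mset (durfee ps)) {ps. admissible d l ps}"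
    by (rule inj_on_subset [OF inj_on_mset_durfee]) (auto simp: admissible_iff_spaced)
  have sub: "(\<lambda>ps. mset (durfee ps)) ` {ps. admissible d l ps} \<subseteq> partitions d l"
    using mset_durfee_in_partitions by blast
  from inj_on_finite [OF inj sub finite_partitions] card_inj_on_le [OF inj sub finite_partitions]
  show ?thesis ..
qed

subsection \<open>The monomial basis\<close>

lemma single_one_eq_iff: "Poly_Mapping.single m (1 :: 'b :: zero_neq_one) = Poly_Mapping.single m' 1 \<longleftrightarrow> m = m'"
  by (metis lookup_single_eq lookup_single_not_eq zero_neq_one)

lemma prod_mset_var_x:
  "(\<Prod>x\<in>#M. var_x x) = Poly_Mapping.single (\<Sum>x\<in>#M. Poly_Mapping.single (x - 1) 1) 1"
proof (induction M)
  case empty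
  then show ?case by simp
next
  case (add x M)
  then show ?case by (simp add: var_x_def mult_single)
qed

lemma lookup_sum_mset_single:
  "Poly_Mapping.lookup (\<Sum>x\<in>#M. Poly_Mapping.single (f x) (1 :: nat)) k = count (image_mset f M) k"
  by (induction M) (auto simp: lookup_add lookup_single)

lemma inj_on_prod_mset_var_x: "inj_on (\<lambda>M. \<Prod>x\<in>#M. var_x x) (partitions d l)"
proof (rule inj_onI)
  fix M M' assume M: "M \<in> partitions d l" "M' \<in> partitions d l"
    and "(\<Prod>x\<in>#M. var_x x) = (\<Prod>x\<in>#M'. var_x x)"
  then have "(\<Sum>x\<in>#M. Poly_Mapping.single (x - 1) (1 :: nat)) = (\<Sum>x\<in>#M'. Poly_Mapping.single (x - 1) 1)"
    by (simp add: prod_mset_var_x single_one_eq_iff)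
  then have "image_mset (\<lambda>x. x - 1) M = image_mset (\<lambda>x. x - 1) M'"
    by (intro multiset_eqI) (simp flip: lookup_sum_mset_single)
  \<comment> \<open>\<open>Suc\<close> undoes the index shift \<open>x - 1\<close> because all parts
    are positive.\<close>
  then have "image_mset Suc (image_mset (\<lambda>x. x - 1) M) = image_mset Suc (image_mset (\<lambda>x. x - 1) M')"
    by simp
  moreover have "image_mset Suc (image_mset (\<lambda>x. x - 1) K) = K" if "K \<in> partitions d l" for K
  proof -
    have "image_mset Suc (image_mset (\<lambda>x. x - 1) K) = image_mset (\<lambda>x. x) K"
      unfolding image_mset.compositionality
      using that by (intro image_mset_cong) (auto simp: partitions_def)
    then show ?thesis by simp
  qed
  ultimately show "M = M'"
    using M by simp
qed

lemma monomials_eq: "monomials d l = (\<lambda>M. \<Prod>x\<in>#M. var_x x) ` partitions d l"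
proof (intro equalityI subsetI)
  fix p assume "p \<in> monomials d l"
  then obtain xs where "p = prod_list (map var_x xs)" "length xs = l" "sum_list xs = d" "\<forall>i\<in>set xs. i \<ge> 1"
    by (auto simp: monomials_def)
  then show "p \<in> (\<lambda>M. \<Prod>x\<in>#M. var_x x) ` partitions d l"
    by (intro image_eqI [of _ _ "mset xs"])
      (auto simp: partitions_def sum_mset_sum_list simp flip: prod_mset_prod_list)
next
  fix p assume "p \<in> (\<lambda>M. \<Prod>x\<in>#M. var_x x) ` partitions d l"
  then obtain M where M: "p = (\<Prod>x\<in>#M. var_x x)" "M \<in> partitions d l" by blast
  obtain xs where "mset xs = M"
    using ex_mset by blast
  with M show "p \<in> monomials d l"
    by (auto simp: monomials_def partitions_def sum_mset_sum_list simp flip: prod_mset_prod_list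
        intro!: exI [of _ xs])
qed

lemma independent_singles:
  assumes "finite A"
  shows "independent ((\<lambda>m. Poly_Mapping.single m (1 :: real)) ` A)"
proof (rule independent_if_scalars_zero)
  have inj: "inj_on (\<lambda>m. Poly_Mapping.single m (1 :: real)) A"
    by (rule inj_onI) (simp add: single_one_eq_iff)
  fix f :: "('a \<Rightarrow>\<^sub>0 real) \<Rightarrow> real" and p :: "'a \<Rightarrow>\<^sub>0 real"
  assume "(\<Sum>p\<in>(\<lambda>m. Poly_Mapping.single m 1) ` A. f p *\<^sub>R p) = 0"
    and "p \<in> (\<lambda>m. Poly_Mapping.single m 1) ` A"
  then obtain m where m: "m \<in> A" "p = Poly_Mapping.single m 1"
    and "(\<Sum>m\<in>A. Poly_Mapping.single m (f (Poly_Mapping.single m 1))) = 0"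
    by (auto simp: sum.reindex [OF inj])
  then have "0 = Poly_Mapping.lookup (\<Sum>m\<in>A. Poly_Mapping.single m (f (Poly_Mapping.single m 1))) m"
    by simp
  also have "\<dots> = f p"
    using assms m by (simp add: lookup_sum lookup_single when_def)
  finally show "f p = 0" by simp
qed (use assms in simp)

lemma independent_monomials: "independent (monomials d l)"
proof -
  have eq: "monomials d l = (\<lambda>m. Poly_Mapping.single m 1) `
      (\<lambda>M. \<Sum>x\<in>#M. Poly_Mapping.single (x - 1) 1) ` partitions d l"
    by (simp add: monomials_eq prod_mset_var_x image_image)
  show ?thesis
    unfolding eq by (intro independent_singles finite_imageI finite_partitions)
qed

lemma card_monomials: "card (monomials d l) = card (partitions d l)"
  unfolding monomials_eq by (rule card_image [OF inj_on_prod_mset_var_x])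

text \<open>Otherwise some functional is 1 at \<open>x\<close> and 0 on a basis of
  \<open>span S\<close>. This turns the reductions, phrased through functionals, into membership in
  a span.\<close>

lemma in_span_if_functionals_eq_0:
  fixes x :: "'a :: real_vector"
  assumes "\<And>\<phi> :: 'a \<Rightarrow> real. linear \<phi> \<Longrightarrow> (\<And>y. y \<in> S \<Longrightarrow> \<phi> y = 0) \<Longrightarrow> \<phi> x = 0"
  shows "x \<in> span S"
proof (rule ccontr)
  assume x: "x \<notin> span S"
  obtain B where B: "B \<subseteq> S" "independent B" "S \<subseteq> span B"
    by (rule maximal_independent_subset)
  then have "span B = span S"
    by (metis span_mono span_span subset_antisym)
  then have "independent (insert x B)" "x \<notin> B"
    using x B by (auto simp: independent_insert span_base)
  from linear_independent_extend [OF this(1), of "\<lambda>y. if y = x then 1 else 0 :: real"]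
  obtain \<phi> :: "'a \<Rightarrow> real"
    where \<phi>: "linear \<phi>" "\<forall>y\<in>insert x B. \<phi> y = (if y = x then 1 else 0)"
    by blast
  have "\<phi> y = 0" if "y \<in> S" for y
  proof (rule linear_eq_0_on_span [OF \<phi>(1)])
    show "y \<in> span B"
      using that B(3) by blast
    show "\<phi> b = 0" if "b \<in> B" for b
      using \<phi>(2) that \<open>x \<notin> B\<close> by auto
  qed
  from assms [OF \<phi>(1) this] have "\<phi> x = 0" .
  with \<phi>(2) show False by simp
qed

lemma monomials_subset_span_S_set:
  assumes "l \<ge> 1"
  shows "monomials d l \<subseteq> span (S_set d l)"
proof
  fix p assume "p \<in> monomials d l"
  then obtain M where M: "M \<in> partitions d l" "p = (\<Prod>x\<in>#M. var_x x)"
    by (auto simp: monomials_eq)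
  define M' where "M' = image_mset (\<lambda>x. (x, 1 :: nat)) M"
  have "p = g_mset M'"
    unfolding M(2) M'_def image_mset.compositionality
    using M(1) by (intro arg_cong [where f = prod_mset] image_mset_cong) (auto simp: partitions_def g_poly_1 [simplified])
  moreover have "\<forall>p\<in>#M'. snd p \<ge> 1" "(\<Sum>p\<in>#M'. fst p) = d" "(\<Sum>p\<in>#M'. snd p) = l"
    using M(1) by (auto simp: M'_def partitions_def image_mset.compositionality o_def)
  ultimately show "p \<in> span (S_set d l)"
    by (simp only:) (rule in_span_if_functionals_eq_0, rule functional_g_mset_eq_0 [OF _ _ assms])
qed

theorem theorem3:
  fixes d l :: nat
  assumes "d \<ge> l" and "l \<ge> 1"
  shows "S_set d l \<subseteq> F_space d l \<and> independent (S_set d l) \<and> span (S_set d l) = F_space d l"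
proof (intro conjI)
  show sub: "S_set d l \<subseteq> F_space d l"
    by (rule S_set_subset_F_space)
  have "F_space d l \<subseteq> span (S_set d l)"
    unfolding F_space_def
    by (rule span_minimal [OF monomials_subset_span_S_set [OF assms(2)] subspace_span])
  moreover have "span (S_set d l) \<subseteq> F_space d l"
    using sub unfolding F_space_def by (rule span_minimal) (rule subspace_span)
  ultimately show "span (S_set d l) = F_space d l" by blast
  have S: "S_set d l = (\<lambda>ps. prod_list (map (\<lambda>(d', l'). g_poly d' l') ps)) ` {ps. admissible d l ps}"
    by (auto simp: S_set_def)
  have fin: "finite (S_set d l)"
    unfolding S using card_admissible_le by blast
  have "card (S_set d l) \<le> card {ps. admissible d l ps}"
    unfolding S using card_admissible_le by (blast intro: card_image_le)
  then have card: "card (S_set d l) \<le> card (monomials d l)"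
    using card_admissible_le [of d l] by (simp add: card_monomials)
  \<comment> \<open>\<open>B\<close> spans the independent monomials, so it has at least as many
    elements as they, hence as \<open>S_set d l\<close>; being a subset of that finite set, it is
    all of it.\<close>
  obtain B where B: "B \<subseteq> S_set d l" "independent B" "S_set d l \<subseteq> span B"
    by (rule maximal_independent_subset)
  have "monomials d l \<subseteq> span B"
    using monomials_subset_span_S_set [OF assms(2)] span_minimal [OF B(3) subspace_span] by blast
  then have "card (monomials d l) \<le> card B"
    using independent_span_bound [OF finite_subset [OF B(1) fin] independent_monomials] by blast
  then have "B = S_set d l"
    using card by (intro card_seteq [OF fin B(1)]) simp
  with B(2) show "independent (S_set d l)" by simp
qed

end
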